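(* Let $k\in\mathbb N$, $k\ge2$, and let $q\in\mathbb C$ be such that $q\neq1$ and $q^k=1$. Let $X=\mathbb R^d$ with $d\ge 2$, let $\eta\in\mathbb R$, and let $Q:X^2\to\mathbb C$ be given by $Q(x,y)=q$ if $x^1<y^1$, $Q(x,y)=\bar q$ if $x^1>y^1$, $Q(x,y)=\eta$ if $x^1=y^1$. Then in the ACR algebra (i.e. for any system of operator-valued integrals satisfying (A1)--(A5) below with this $Q$) one has, for each $h\in\mathscr H_{\mathbb C}$, $$\Big(\int_X m(dx)\,h(x)\,\partial_x^+\Big)^k=0,$$ where $\int_X m(dx)\,h(x)\partial_x^+:=I^{(1)}_{+}(h,1)$.
   Context: $m$ is the Lebesgue measure on $X=\mathbb R^d$, $d\ge2$; $x^i$ is the $i$-th coordinate of $x\in X$; $\mathscr H_{\mathbb C}=L^2(X\to\mathbb C,m)$. The function $Q(x,y)$ depends only on $x^1,y^1$, and we also write $Q(s,t)$, $s,t\in\mathbb R$, for $Q(x,y)$ with $x^1=s$, $y^1=t$ (so $Q(s,s)=\eta$). Measures. For signs $\sharp_1,\dots,\sharp_k\in\{+,-\}$ let $\Pi(k,\sharp_1,\dots,\sharp_k)$ be the set of partitions $\theta$ of $\{1,\dots,k\}$ all of whose blocks have at most two elements and such that $\sharp_a\ne\sharp_b$ whenever $\{a,b\}$ is a two-element block. For a non-atomic measure $\mu$ on a space $Y$ and $\theta=\{\theta_1,\dots,\theta_l\}$ with $\min\theta_1<\dots<\min\theta_l$, let $\mu^{(k)}_\theta$ be the pushforward of $\mu^{\otimes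 l}$ under $Y^l\ni(y_1,\dots,y_l)\mapsto(z_1,\dots,z_k)\in Y^k$, $z_i=y_j$ for $i\in\theta_j$; put $\mu^{(k)}_{\sharp_1,\dots,\sharp_k}=\sum_{\theta\in\Pi(k,\sharp_1,\dots,\sharp_k)}\mu^{(k)}_\theta$. For $\mu=m$ on $X$ this gives $m^{(k)}_{\sharp_1,\dots,\sharp_k}$ on $X^k$; for $\mu$ the Lebesgue measure on $\mathbb R$ it gives $\nu^{(k)}_{\sharp_1,\dots,\sharp_k}$ on $\mathbb R^k$. Operator-valued integrals and the $Q$-CR algebra. Let $\mathscr G$ be a separable complex Hilbert space and $\Theta\subset\mathscr G$ a dense linear subspace. Suppose that for all $k\ge1$, $\sharp_1,\dots,\sharp_k\in\{+,-\}$, $h_1,\dots,h_k\in\mathscr H_{\mathbb C}$ and $v^{(k)}\in L^\infty(\mathbb R^k\to\mathbb C,\nu^{(k)}_{\sharp_1,\dots,\sharp_k})$ a linear operator $I^{(k)}_{\sharp_1,\dots,\sharp_k}(h_1,\dots,h_k,v^{(k)}):\Theta\to\Theta$ is given (informally $\int_{X^k}m^{\otimes k}(dx_1\cdots dx_k)\,h_1(x_1)\cdots h_k(x_k)v^{(k)}(x_1^1,\dots,x_k^1)\,\partial^{\sharp_1}_{x_1}\cdots\partial^{\sharp_k}_{x_k}$). The operator $I^{(0)}(u)$, $u\in\mathbb C$, means $u\mathbf 1$. The axioms are: (A1) If $h_1(x_1)\cdots h_k(x_k)v^{(k)}(x_1^1,\dots,x_k^1)=g_1(x_1)\cdots g_k(x_k)w^{(k)}(x_1^1,\dots,x_k^1)$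 for $m^{(k)}_{\sharp_1,\dots,\sharp_k}$-a.e. $(x_1,\dots,x_k)$, then $I^{(k)}_{\sharp_1,\dots,\sharp_k}(h_1,\dots,h_k,v^{(k)})=I^{(k)}_{\sharp_1,\dots,\sharp_k}(g_1,\dots,g_k,w^{(k)})$. (A2) $I^{(k)}_{\sharp_1,\dots,\sharp_k}(h_1,\dots,h_k,v^{(k)})$ is linear in each $h_i$ and in $v^{(k)}$. (A3) The adjoint of $I^{(k)}_{\sharp_1,\dots,\sharp_k}(h_1,\dots,h_k,v^{(k)})$ contains $\Theta$ in its domain and its restriction to $\Theta$ is $I^{(k)}_{\triangle_k,\dots,\triangle_1}(\overline{h_k},\dots,\overline{h_1},v^{(k)*})$, where $\triangle_i$ is the sign opposite to $\sharp_i$ and $v^{(k)*}(s_1,\dots,s_k)=\overline{v^{(k)}(s_k,\dots,s_1)}$. (A4) ($Q$-commutation relations) Let $k\ge2$, $1\le i\le k-1$. If $\sharp_i=\sharp_{i+1}$, then $I^{(k)}_{\sharp_1,\dots,\sharp_k}(h_1,\dots,h_k,v^{(k)})=I^{(k)}_{\sharp_1,\dots,\sharp_k}(h_1,\dots,h_{i-1},h_{i+1},h_i,h_{i+2},\dots,h_k,\Psi_iv^{(k)})$ with $(\Psi_iv^{(k)})(s_1,\dots,s_k)=v^{(k)}(s_1,\dots,s_{i-1},s_{i+1},s_i,s_{i+2},\dots,s_k)\,Q(s_i,s_{i+1})$. If $\sharp_i=-$ and $\sharp_{i+1}=+$, then $$I^{(k)}_{\sharp_1,\dots,\sharp_k}(h_1,\dots,h_k,v^{(k)})=I^{(k-2)}_{\sharp_1,\dots,\sharp_{i-1},\sharp_{i+2},\dots,\sharp_k}(h_1,\dots,h_{i-1},h_{i+2},\dots,h_k,u^{(k-2)})+I^{(k)}_{\sharp_1,\dots,\sharp_{i-1},\sharp_{i+1},\sharp_i,\sharp_{i+2},\dots,\sharp_k}(h_1,\dots,h_{i-1},h_{i+1},h_i,h_{i+2},\dots,h_k,\Psi_i'v^{(k)}),$$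 with $u^{(k-2)}(s_1,\dots,s_{k-2})=\int_Xh_i(x)h_{i+1}(x)v^{(k)}(s_1,\dots,s_{i-1},x^1,x^1,s_i,\dots,s_{k-2})\,m(dx)$ and $(\Psi_i'v^{(k)})(s_1,\dots,s_k)=v^{(k)}(s_1,\dots,s_{i-1},s_{i+1},s_i,s_{i+2},\dots,s_k)\,Q(s_{i+1},s_i)$. (A5) $I^{(k)}_{\sharp_1,\dots,\sharp_k}(h_1,\dots,h_k,v^{(k)})\,I^{(n)}_{\sharp_{k+1},\dots,\sharp_{k+n}}(h_{k+1},\dots,h_{k+n},w^{(n)})=I^{(k+n)}_{\sharp_1,\dots,\sharp_{k+n}}(h_1,\dots,h_{k+n},v^{(k)}\otimes w^{(n)})$. The complex algebra $\mathbf A$ of operators on $\Theta$ generated by the operator-valued integrals is called the $Q$-CR algebra; when $Q$ is the function given, for some $q\in\mathbb C$ with $|q|=1$ and $\eta\in\mathbb R$, by $Q(x,y)=q$ if $x^1<y^1$, $Q(x,y)=\bar q$ if $x^1>y^1$, and $Q(x,y)=\eta$ if $x^1=y^1$, it is called the ACR algebra (anyon commutation relations). *)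

theory Defs
  imports "HOL-Analysis.Analysis" "HOL-Library.Disjoint_Sets"
begin

section \<open>Complex Hilbert spaces and operators on a dense subspace\<close>

text \<open>The norm, the metric and completeness come from \<^class>\<open>banach\<close>. The inner product is linear
  in its first argument.\<close>

class complex_hilbert_space = banach +
  fixes scaleC :: "complex \<Rightarrow> 'a \<Rightarrow> 'a" (infixr "*\<^sub>C" 75)
    and cinner :: "'a \<Rightarrow> 'a \<Rightarrow> complex"
  assumes scaleC_add_right: "c *\<^sub>C (x + y) = c *\<^sub>C x + c *\<^sub>C y"
    and scaleC_add_left: "(b + c) *\<^sub>C x = b *\<^sub>C x + c *\<^sub>C x"
    and scaleC_scaleC: "b *\<^sub>C c *\<^sub>C x = (b * c) *\<^sub>C x"
    and scaleR_scaleC: "r *\<^sub>R x = complex_of_real r *\<^sub>C x"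
    and cinner_commute: "cinner x y = cnj (cinner y x)"
    and cinner_add_left: "cinner (x + y) z = cinner x z + cinner y z"
    and cinner_scaleC_left: "cinner (c *\<^sub>C x) y = c * cinner x y"
    and cinner_norm: "cinner x x = complex_of_real ((norm x)\<^sup>2)"

global_interpretation complex_vector:
  vector_space "scaleC :: complex \<Rightarrow> 'a \<Rightarrow> 'a::complex_hilbert_space"
proof
  fix x :: 'a
  show "1 *\<^sub>C x = x"
    using scaleR_scaleC[of 1 x] by simp
qed (rule scaleC_add_right scaleC_add_left scaleC_scaleC)+

text \<open>Operators on a subspace \<open>\<Theta>\<close> are represented by total functions of which only the values on
  \<open>\<Theta>\<close> matter.\<close>

definition linear_operator_on :: "'g::complex_hilbert_space set \<Rightarrow> ('g \<Rightarrow> 'g) \<Rightarrow> bool" where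
  "linear_operator_on \<Theta> T \<longleftrightarrow>
     (\<forall>f\<in>\<Theta>. T f \<in> \<Theta>) \<and>
     (\<forall>f\<in>\<Theta>. \<forall>g\<in>\<Theta>. T (f + g) = T f + T g) \<and>
     (\<forall>c. \<forall>f\<in>\<Theta>. T (c *\<^sub>C f) = c *\<^sub>C T f)"

text \<open>The graph of the adjoint of the operator \<open>T\<close> with domain \<open>\<Theta>\<close>; it is single-valued when
  \<open>\<Theta>\<close> is dense.\<close>

definition adjoint_graph ::
    "'g::complex_hilbert_space set \<Rightarrow> ('g \<Rightarrow> 'g) \<Rightarrow> ('g \<times> 'g) set" where
  "adjoint_graph \<Theta> T = {(g, g'). \<forall>f\<in>\<Theta>. cinner (T f) g = cinner f g'}"

section \<open>The measures indexed by signs\<close>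

datatype sign = Pos | Neg

fun opposite :: "sign \<Rightarrow> sign" where
  "opposite Pos = Neg"
| "opposite Neg = Pos"

text \<open>Indices start from 0, so a \<open>k\<close>-tuple is a list of length \<open>k\<close> or, for points of a product space,
  an element of the extensional product over \<open>{..<k}\<close>.\<close>

definition sign_partitions :: "sign list \<Rightarrow> nat set set set" where
  "sign_partitions ss =
     {\<theta>. partition_on {..<length ss} \<theta> \<and> (\<forall>B\<in>\<theta>. card B \<le> 2) \<and>
         (\<forall>a b. a \<noteq> b \<longrightarrow> {a, b} \<in> \<theta> \<longrightarrow> ss ! a \<noteq> ss ! b)}"

text \<open>The power of \<open>M\<close> with one factor for each block is indexed by the blocks themselves, which
  makes an enumeration of the blocks unnecessary.\<close>

definition partition_measure :: "'a measure \<Rightarrow> nat \<Rightarrow> nat set set \<Rightarrow> (nat \<Rightarrow> 'a) measure" where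
  "partition_measure M k \<theta> =
     distr (\<Pi>\<^sub>M B\<in>\<theta>. M) (\<Pi>\<^sub>M i\<in>{..<k}. M) (\<lambda>y. \<lambda>i\<in>{..<k}. y (THE B. B \<in> \<theta> \<and> i \<in> B))"

definition sign_measure :: "'a measure \<Rightarrow> sign list \<Rightarrow> (nat \<Rightarrow> 'a) measure" where
  "sign_measure M ss =
     measure_of (space (\<Pi>\<^sub>M i\<in>{..<length ss}. M)) (sets (\<Pi>\<^sub>M i\<in>{..<length ss}. M))
       (\<lambda>A. \<Sum>\<theta>\<in>sign_partitions ss. emeasure (partition_measure M (length ss) \<theta>) A)"

text \<open>Elements of the Lebesgue spaces are represented by Borel functions, not by classes modulo
  equality almost everywhere; the axiom \<open>AE_cong\<close> below makes the integrals independent of the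
  representatives.\<close>

definition L2 :: "('a::euclidean_space \<Rightarrow> complex) set" where
  "L2 = {h \<in> borel_measurable lborel. integrable lborel (\<lambda>x. (cmod (h x))\<^sup>2)}"

definition Linf :: "sign list \<Rightarrow> ((nat \<Rightarrow> real) \<Rightarrow> complex) set" where
  "Linf ss = {v \<in> borel_measurable (sign_measure lborel ss).
                \<exists>C. AE s in sign_measure lborel ss. cmod (v s) \<le> C}"

section \<open>Systems of operator-valued integrals\<close>

definition swap_at :: "nat \<Rightarrow> 'a list \<Rightarrow> 'a list" where
  "swap_at i xs = xs[i := xs ! Suc i, Suc i := xs ! i]"

definition delete_two_at :: "nat \<Rightarrow> 'a list \<Rightarrow> 'a list" where
  "delete_two_at i xs = take i xs @ drop (i + 2) xs"

text \<open>With \<open>e\<close> the index of the distinguished (first) coordinate, the following is the integrand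
  without the operator symbols.\<close>

definition integrand ::
    "'d::finite \<Rightarrow> (real^'d \<Rightarrow> complex) list \<Rightarrow> ((nat \<Rightarrow> real) \<Rightarrow> complex) \<Rightarrow> (nat \<Rightarrow> real^'d) \<Rightarrow> complex"
  where
  "integrand e hs v x = (\<Prod>i<length hs. (hs ! i) (x i)) * v (\<lambda>i\<in>{..<length hs}. x i $ e)"

definition star :: "nat \<Rightarrow> ((nat \<Rightarrow> real) \<Rightarrow> complex) \<Rightarrow> (nat \<Rightarrow> real) \<Rightarrow> complex" where
  "star k v = (\<lambda>s. cnj (v (\<lambda>i\<in>{..<k}. s (k - 1 - i))))"

definition Psi ::
    "(real \<Rightarrow> real \<Rightarrow> complex) \<Rightarrow> nat \<Rightarrow> ((nat \<Rightarrow> real) \<Rightarrow> complex) \<Rightarrow> (nat \<Rightarrow> real) \<Rightarrow> complex" where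
  "Psi Q i v = (\<lambda>s. v (s(i := s (Suc i), Suc i := s i)) * Q (s i) (s (Suc i)))"

definition Psi' ::
    "(real \<Rightarrow> real \<Rightarrow> complex) \<Rightarrow> nat \<Rightarrow> ((nat \<Rightarrow> real) \<Rightarrow> complex) \<Rightarrow> (nat \<Rightarrow> real) \<Rightarrow> complex" where
  "Psi' Q i v = (\<lambda>s. v (s(i := s (Suc i), Suc i := s i)) * Q (s (Suc i)) (s i))"

definition contraction ::
    "'d::finite \<Rightarrow> nat \<Rightarrow> (real^'d \<Rightarrow> complex) list \<Rightarrow> ((nat \<Rightarrow> real) \<Rightarrow> complex) \<Rightarrow> (nat \<Rightarrow> real) \<Rightarrow> complex"
  where
  "contraction e i hs v = (\<lambda>s. LINT x|lborel. (hs ! i) x * (hs ! Suc i) x *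
     v (\<lambda>j\<in>{..<length hs}. if j < i then s j else if j < i + 2 then x $ e else s (j - 2)))"

definition tensor ::
    "nat \<Rightarrow> nat \<Rightarrow> ((nat \<Rightarrow> real) \<Rightarrow> complex) \<Rightarrow> ((nat \<Rightarrow> real) \<Rightarrow> complex) \<Rightarrow> (nat \<Rightarrow> real) \<Rightarrow> complex"
  where
  "tensor k n v w = (\<lambda>s. v (\<lambda>i\<in>{..<k}. s i) * w (\<lambda>i\<in>{..<n}. s (k + i)))"

definition admissible ::
    "sign list \<Rightarrow> (real^'d::finite \<Rightarrow> complex) list \<Rightarrow> ((nat \<Rightarrow> real) \<Rightarrow> complex) \<Rightarrow> bool" where
  "admissible ss hs v \<longleftrightarrow> length hs = length ss \<and> set hs \<subseteq> L2 \<and> v \<in> Linf ss"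

text \<open>\<open>I ss hs v\<close> is the integral of order \<open>k = length ss\<close>. Order 0 is the convention that it is
  multiplication by the constant \<open>v\<close>; the only point of the empty product is \<open>\<lambda>_. undefined\<close>.
  All identities between operators are identities on \<open>\<Theta>\<close>.\<close>

locale operator_integrals =
  fixes e :: "'d::finite"
    and Q :: "real \<Rightarrow> real \<Rightarrow> complex"
    and \<Theta> :: "'g::complex_hilbert_space set"
    and I :: "sign list \<Rightarrow> (real^'d \<Rightarrow> complex) list \<Rightarrow> ((nat \<Rightarrow> real) \<Rightarrow> complex) \<Rightarrow> 'g \<Rightarrow> 'g"
  assumes separable: "\<exists>D::'g set. countable D \<and> closure D = UNIV"
    and subspace: "complex_vector.subspace \<Theta>"
    and dense: "closure \<Theta> = UNIV"
    and operator: "\<And>ss hs v. ss \<noteq> [] \<Longrightarrow> admissible ss hs v \<Longrightarrow> linear_operator_on \<Theta> (I ss hs v)"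
    and order_0: "\<And>v f. f \<in> \<Theta> \<Longrightarrow> I [] [] v f = v (\<lambda>_. undefined) *\<^sub>C f"
    and AE_cong:
      "\<And>ss hs v gs w f. ss \<noteq> [] \<Longrightarrow> admissible ss hs v \<Longrightarrow> admissible ss gs w \<Longrightarrow>
         (AE x in sign_measure lborel ss. integrand e hs v x = integrand e gs w x) \<Longrightarrow>
         f \<in> \<Theta> \<Longrightarrow> I ss hs v f = I ss gs w f"
    and linear_h:
      "\<And>ss hs v i g g' a b f. i < length ss \<Longrightarrow> admissible ss hs v \<Longrightarrow> g \<in> L2 \<Longrightarrow> g' \<in> L2 \<Longrightarrow>
         f \<in> \<Theta> \<Longrightarrow>
         I ss (hs[i := \<lambda>x. a * g x + b * g' x]) v f =
           a *\<^sub>C I ss (hs[i := g]) v f + b *\<^sub>C I ss (hs[i := g']) v f"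
    and linear_v:
      "\<And>ss hs v w a b f. ss \<noteq> [] \<Longrightarrow> admissible ss hs v \<Longrightarrow> admissible ss hs w \<Longrightarrow> f \<in> \<Theta> \<Longrightarrow>
         I ss hs (\<lambda>s. a * v s + b * w s) f = a *\<^sub>C I ss hs v f + b *\<^sub>C I ss hs w f"
    and adjoint:
      "\<And>ss hs v g. ss \<noteq> [] \<Longrightarrow> admissible ss hs v \<Longrightarrow> g \<in> \<Theta> \<Longrightarrow>
         (g, I (map opposite (rev ss)) (map (\<lambda>h x. cnj (h x)) (rev hs)) (star (length ss) v) g)
           \<in> adjoint_graph \<Theta> (I ss hs v)"
    and commutation_same:
      "\<And>ss hs v i f. admissible ss hs v \<Longrightarrow> Suc i < length ss \<Longrightarrow> ss ! i = ss ! Suc i \<Longrightarrow>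
         f \<in> \<Theta> \<Longrightarrow> I ss hs v f = I ss (swap_at i hs) (Psi Q i v) f"
    and commutation_Neg_Pos:
      "\<And>ss hs v i f. admissible ss hs v \<Longrightarrow> Suc i < length ss \<Longrightarrow>
         ss ! i = Neg \<Longrightarrow> ss ! Suc i = Pos \<Longrightarrow> f \<in> \<Theta> \<Longrightarrow>
         I ss hs v f =
           I (delete_two_at i ss) (delete_two_at i hs) (contraction e i hs v) f +
           I (swap_at i ss) (swap_at i hs) (Psi' Q i v) f"
    and product:
      "\<And>ss hs v ss' hs' w f. ss \<noteq> [] \<Longrightarrow> ss' \<noteq> [] \<Longrightarrow>
         admissible ss hs v \<Longrightarrow> admissible ss' hs' w \<Longrightarrow> f \<in> \<Theta> \<Longrightarrow>
         I ss hs v (I ss' hs' w f) =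
           I (ss @ ss') (hs @ hs') (tensor (length ss) (length ss') v w) f"

text \<open>The function \<open>Q(x, y)\<close> depends only on the distinguished coordinates of \<open>x\<close> and \<open>y\<close>, which are
  the arguments \<open>s\<close> and \<open>t\<close> here.\<close>

definition anyon_Q :: "complex \<Rightarrow> real \<Rightarrow> real \<Rightarrow> real \<Rightarrow> complex" where
  "anyon_Q q \<eta> s t = (if s < t then q else if s > t then cnj q else complex_of_real \<eta>)"

end

theory Submission
  imports Defs
begin

text \<open>By \<open>product\<close> the \<open>k\<close>-th power is the integral of order \<open>k\<close> of \<open>h \<otimes> \<dots> \<otimes> h\<close> with
  \<open>v = 1\<close>. For equal signs the measure does not charge the diagonals, so that \<open>1\<close> is the sum of
  the indicators of the sets \<open>E\<^sub>j\<close> of points whose strictly largest coordinate is the \<open>j\<close>-th.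
  The commutation relation at \<open>(j, j + 1)\<close> replaces \<open>E\<^sub>j\<close> by \<open>E\<^bsub>j+1\<^esub>\<close> with the factor \<open>q\<close>,
  hence the power equals \<open>1 + q + \<dots> + q\<^bsup>k-1\<^esup> = 0\<close> times the integral over \<open>E\<^bsub>k-1\<^esub>\<close>.\<close>

section \<open>Sign measures and their null diagonals\<close>

lemma sets_sign_measure:
  "sets (sign_measure M ss) = sets (\<Pi>\<^sub>M i\<in>{..<length ss}. M)"
  unfolding sign_measure_def by (rule sets.sets_measure_of_eq)

lemma space_sign_measure:
  "space (sign_measure M ss) = space (\<Pi>\<^sub>M i\<in>{..<length ss}. M)"
  by (rule sets_eq_imp_space_eq[OF sets_sign_measure])

text \<open>No additivity has to be checked: \<^const>\<open>measure_of\<close> of a set function that is not a measure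
  is the zero measure.\<close>

lemma AE_sign_measureI:
  assumes meas: "{x \<in> space (\<Pi>\<^sub>M i\<in>{..<length ss}. M). \<not> P x} \<in> sets (\<Pi>\<^sub>M i\<in>{..<length ss}. M)"
    and AE: "\<And>\<theta>. \<theta> \<in> sign_partitions ss \<Longrightarrow> AE x in partition_measure M (length ss) \<theta>. P x"
  shows "AE x in sign_measure M ss. P x"
proof (rule AE_I[where N = "{x \<in> space (\<Pi>\<^sub>M i\<in>{..<length ss}. M). \<not> P x}"])
  let ?N = "{x \<in> space (\<Pi>\<^sub>M i\<in>{..<length ss}. M). \<not> P x}"
  show "{x \<in> space (sign_measure M ss). \<not> P x} \<subseteq> ?N"
    by (simp add: space_sign_measure)
  show "?N \<in> sets (sign_measure M ss)"
    using meas by (simp add: sets_sign_measure)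
  have "emeasure (partition_measure M (length ss) \<theta>) ?N = 0" if "\<theta> \<in> sign_partitions ss" for \<theta>
  proof -
    have "?N \<in> sets (partition_measure M (length ss) \<theta>)"
      using meas by (simp add: partition_measure_def)
    moreover have "?N = {x \<in> space (partition_measure M (length ss) \<theta>). \<not> P x}"
      by (simp add: partition_measure_def)
    ultimately show ?thesis
      using AE_iff_measurable AE[OF that] by blast
  qed
  then show "emeasure (sign_measure M ss) ?N = 0"
    unfolding sign_measure_def by (simp add: emeasure_measure_of_conv)
qed

lemma AE_lborel_neq_component: "AE y in lborel. (y :: real^'d::finite) $ e \<noteq> c"
proof -
  \<comment> \<open>Negligibility of a hyperplane is a statement about \<open>lebesgue\<close>, the
    completion; Borel measurability brings it down to \<open>lborel\<close>.\<close>
  have "{y :: real^'d. y $ e = c} \<in> null_sets lebesgue"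
    using negligible_standard_hyperplane[of "axis e 1 :: real^'d" c] negligible_iff_null_sets
    by (auto simp: inner_axis)
  moreover have "{y :: real^'d. y $ e = c} \<in> sets lborel"
    by measurable
  ultimately have "{y :: real^'d. y $ e = c} \<in> null_sets lborel"
    by (rule iffD1[OF null_sets_completion_iff, rotated])
  then show ?thesis
    by (auto dest: AE_not_in)
qed

lemma measurable_PiM_component_nth:
  fixes e :: "'d::finite"
  assumes "i \<in> J"
  shows "(\<lambda>x. x i $ e) \<in> borel_measurable (\<Pi>\<^sub>M i\<in>J. (lborel :: (real^'d) measure))"
proof (rule measurable_compose[OF measurable_component_singleton[OF assms]])
  have "(\<lambda>v :: real^'d. v $ e) \<in> borel_measurable borel"
    by (intro borel_measurable_continuous_onI continuous_intros)
  then show "(\<lambda>v :: real^'d. v $ e) \<in> borel_measurable lborel"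
    by simp
qed

text \<open>Fubini with the coordinate \<open>B\<close> integrated first: since
  \<open>B \<noteq> C\<close>, the value \<open>y C\<close> stays fixed and each slice lies in a
  hyperplane.\<close>

lemma AE_PiM_neq_component:
  fixes e :: "'d::finite" and \<theta> :: "'i set"
  assumes "finite \<theta>" "B \<in> \<theta>" "C \<in> \<theta>" "B \<noteq> C"
  shows "AE y in (\<Pi>\<^sub>M B\<in>\<theta>. (lborel :: (real^'d) measure)). y B $ e \<noteq> y C $ e"
proof -
  interpret product_sigma_finite "\<lambda>_::'i. lborel :: (real^'d) measure"
    by unfold_locales
  let ?J = "\<theta> - {B}"
  have \<theta>: "\<theta> = insert B ?J"
    using assms by auto
  let ?N = "{y \<in> space (\<Pi>\<^sub>M B\<in>\<theta>. (lborel :: (real^'d) measure)). y B $ e = y C $ e}"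
  have N: "?N \<in> sets (\<Pi>\<^sub>M B\<in>\<theta>. (lborel :: (real^'d) measure))"
    using assms by (intro borel_measurable_eq measurable_PiM_component_nth)
  have "emeasure (\<Pi>\<^sub>M B\<in>\<theta>. (lborel :: (real^'d) measure)) ?N
      = (\<integral>\<^sup>+ y. indicator ?N y \<partial>(\<Pi>\<^sub>M B\<in>\<theta>. lborel))"
    using N by simp
  also have "\<dots> = (\<integral>\<^sup>+ y. indicator ?N y \<partial>(\<Pi>\<^sub>M B\<in>insert B ?J. lborel))"
    using \<theta> by simp
  also have "\<dots> = (\<integral>\<^sup>+ x. (\<integral>\<^sup>+ y. indicator ?N (x(B := y)) \<partial>lborel) \<partial>(\<Pi>\<^sub>M B\<in>?J. lborel))"
    \<comment> \<open>\<open>insert_Diff_single\<close> would rewrite \<open>insert B ?J\<close> to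
      \<open>insert B \<theta>\<close> and lose the split.\<close>
    using assms(1) N \<theta> by (intro product_nn_integral_insert) (auto simp del: insert_Diff_single)
  also have "\<dots> = (\<integral>\<^sup>+ x. 0 \<partial>(\<Pi>\<^sub>M B\<in>?J. (lborel :: (real^'d) measure)))"
  proof (rule nn_integral_cong)
    fix x :: "'i \<Rightarrow> real^'d"
    have "(\<integral>\<^sup>+ y. indicator ?N (x(B := y)) \<partial>lborel) = (\<integral>\<^sup>+ (y :: real^'d). 0 \<partial>lborel)"
      by (rule nn_integral_cong_AE)
        (use AE_lborel_neq_component[of e "x C $ e"] assms(4) in
          \<open>auto elim!: eventually_mono simp: indicator_def\<close>)
    then show "(\<integral>\<^sup>+ y. indicator ?N (x(B := y)) \<partial>lborel) = 0"
      by simp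
  qed
  finally show ?thesis
    by (intro AE_I[OF _ _ N]) auto
qed

text \<open>Equal signs keep \<open>i\<close> and \<open>j\<close> out of a common block, so under
  every \<open>partition_measure\<close> the two entries are copies of different variables.\<close>

lemma AE_sign_measure_neq_component:
  fixes e :: "'d::finite"
  assumes "i < length ss" "j < length ss" "i \<noteq> j" "ss ! i = ss ! j"
  shows "AE x in sign_measure (lborel :: (real^'d) measure) ss. x i $ e \<noteq> x j $ e"
proof (rule AE_sign_measureI)
  let ?M = "\<Pi>\<^sub>M i\<in>{..<length ss}. (lborel :: (real^'d) measure)"
  have comp: "(\<lambda>x. x l $ e) \<in> borel_measurable ?M" if "l < length ss" for l
    using that by (intro measurable_PiM_component_nth) simp
  show "{x \<in> space ?M. \<not> x i $ e \<noteq> x j $ e} \<in> sets ?M"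
    unfolding not_not by (intro borel_measurable_eq comp assms)
  fix \<theta> assume \<theta>: "\<theta> \<in> sign_partitions ss"
  \<comment> \<open>The same description as in \<open>partition_measure\<close>, so that its
    unfolding matches below.\<close>
  let ?B = "\<lambda>i. THE B. B \<in> \<theta> \<and> i \<in> B"
  have part: "partition_on {..<length ss} \<theta>"
    using \<theta> by (simp add: sign_partitions_def)
  have B: "?B l \<in> \<theta> \<and> l \<in> ?B l" if "l < length ss" for l
  proof (rule theI')
    show "\<exists>!B. B \<in> \<theta> \<and> l \<in> B"
      using partition_onD1[OF part] partition_onD2[OF part] that by (auto simp: disjoint_def)
  qed
  have fin: "finite \<theta>"
    using part by (meson finite_elements finite_lessThan)
  \<comment> \<open>A common block, having at most two elements, would be \<open>{i, j}\<close>,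
    which \<open>sign_partitions\<close> allows only for different signs.\<close>
  have "?B i \<noteq> ?B j"
  proof
    assume eq: "?B i = ?B j"
    have ij: "{i, j} \<subseteq> ?B i"
      using B[OF assms(1)] B[OF assms(2)] eq by auto
    have "finite (?B i)"
    proof (rule finite_subset)
      show "?B i \<subseteq> {..<length ss}"
        unfolding partition_onD1[OF part] using B[OF assms(1)] by blast
    qed simp
    moreover have "\<forall>B\<in>\<theta>. card B \<le> 2"
      using \<theta> by (simp add: sign_partitions_def)
    then have "card (?B i) \<le> 2"
      using B[OF assms(1)] by blast
    then have "card (?B i) \<le> card {i, j}"
      using assms(3) by simp
    ultimately have "{i, j} = ?B i"
      by (intro card_seteq ij)
    then have "{i, j} \<in> \<theta>"
      using B[OF assms(1)] by metis
    with \<theta> assms(3,4) show False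
      by (auto simp: sign_partitions_def)
  qed
  from AE_PiM_neq_component[OF fin _ _ this, of e] B assms(1,2)
  have "AE y in (\<Pi>\<^sub>M B\<in>\<theta>. (lborel :: (real^'d) measure)). y (?B i) $ e \<noteq> y (?B j) $ e"
    by blast
  moreover have "(\<lambda>y. \<lambda>i\<in>{..<length ss}. y (?B i)) \<in> measurable (\<Pi>\<^sub>M B\<in>\<theta>. lborel) ?M"
    by (intro measurable_restrict measurable_component_singleton) (use B in auto)
  moreover have "{x \<in> space ?M. x i $ e \<noteq> x j $ e} \<in> sets ?M"
    by (intro borel_measurable_neq comp assms)
  ultimately show "AE x in partition_measure (lborel :: (real^'d) measure) (length ss) \<theta>. x i $ e \<noteq> x j $ e"
    unfolding partition_measure_def using assms(1,2) by (subst AE_distr_iff) auto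
qed

section \<open>Indicators for the position of the strict maximum\<close>

definition max_at :: "nat \<Rightarrow> nat \<Rightarrow> (nat \<Rightarrow> real) \<Rightarrow> complex" where
  "max_at k j s = of_bool (\<forall>i\<in>{..<k} - {j}. s i < s j)"

lemma max_at_in_Linf:
  assumes "j < length ss"
  shows "max_at (length ss) j \<in> Linf ss"
proof -
  let ?M = "\<Pi>\<^sub>M i\<in>{..<length ss}. (lborel :: real measure)"
  have comp: "(\<lambda>s. s l) \<in> borel_measurable ?M" if "l < length ss" for l
    using measurable_component_singleton[of l "{..<length ss}" "\<lambda>_. lborel :: real measure"] that
    by simp
  have "Measurable.pred ?M (\<lambda>s. \<forall>i\<in>{..<length ss} - {j}. s i < s j)"
    by (intro pred_intros_finite borel_measurable_pred_less comp) (use assms in auto)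
  then have "max_at (length ss) j \<in> borel_measurable ?M"
    unfolding max_at_def[abs_def] of_bool_def by measurable
  then have "max_at (length ss) j \<in> borel_measurable (sign_measure lborel ss)"
    using measurable_cong_sets[OF sets_sign_measure refl] by blast
  moreover have "cmod (max_at (length ss) j s) \<le> 1" for s
    by (simp add: max_at_def)
  ultimately show ?thesis
    by (auto simp: Linf_def)
qed

text \<open>Without ties the maximum is attained at a single index \<open>m\<close>, and only the
  summand at \<open>m\<close> survives.\<close>

lemma sum_max_at:
  assumes "k > 0" "inj_on s {..<k}"
  shows "(\<Sum>j<k. max_at k j s) = 1"
proof -
  have "Max (s ` {..<k}) \<in> s ` {..<k}"
    using assms(1) by (intro Max_in) auto
  then obtain m where m: "m < k" "s m = Max (s ` {..<k})"
    by auto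
  have le: "s i \<le> s m" if "i < k" for i
    using m that by simp
  have "max_at k j s = (if j = m then 1 else 0)" if "j < k" for j
  proof (cases "j = m")
    case True
    then show ?thesis
      using le m(1) assms(2) by (force simp: max_at_def inj_on_def less_le)
  next
    case False
    then show ?thesis
      using le[OF that] m(1) by (auto simp: max_at_def not_less)
  qed
  then show ?thesis
    using m(1) by simp
qed

text \<open>The transposition carries one region to the next. There \<open>s j < s (Suc j)\<close>,
  which selects the branch \<open>q\<close> of \<open>anyon_Q\<close>; elsewhere both sides vanish.
  The identity is pointwise, with no exceptional null set.\<close>

lemma Psi_max_at:
  assumes "Suc j < k"
  shows "Psi (anyon_Q q \<eta>) j (max_at k j) = (\<lambda>s. q * max_at k (Suc j) s)"
proof
  fix s :: "nat \<Rightarrow> real"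
  let ?t = "s(j := s (Suc j), Suc j := s j)"
  have "(\<forall>i\<in>{..<k} - {j}. ?t i < ?t j) \<longleftrightarrow> (\<forall>i\<in>{..<k} - {Suc j}. s i < s (Suc j))" (is "?L \<longleftrightarrow> ?R")
  proof
    assume L: ?L
    show ?R
    proof
      fix i assume i: "i \<in> {..<k} - {Suc j}"
      show "s i < s (Suc j)"
        \<comment> \<open>The instance \<open>Suc j\<close> of \<open>L\<close> reads
          \<open>s j < s (Suc j)\<close> and settles \<open>i = j\<close>; all other entries are
          unmoved by the swap.\<close>
        using bspec[OF L, of "Suc j"] bspec[OF L, of i] i assms by (cases "i = j") auto
    qed
  next
    assume R: ?R
    show ?L
    proof
      fix i assume i: "i \<in> {..<k} - {j}"
      show "?t i < ?t j"
        using bspec[OF R, of j] bspec[OF R, of i] i assms by (cases "i = Suc j") auto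
    qed
  qed
  moreover have "s j < s (Suc j)" if ?R
    using that assms by simp
  ultimately show "Psi (anyon_Q q \<eta>) j (max_at k j) s = q * max_at k (Suc j) s"
    by (auto simp: Psi_def max_at_def anyon_Q_def)
qed

section \<open>Finite sums and powers of operator-valued integrals\<close>

lemma const_in_Linf: "(\<lambda>_. c) \<in> Linf ss"
  by (auto simp: Linf_def)

lemma swap_at_replicate: "Suc i < n \<Longrightarrow> swap_at i (replicate n x) = replicate n x"
  by (auto simp: swap_at_def list_eq_iff_nth_eq nth_list_update)

lemma add_in_Linf:
  assumes "v \<in> Linf ss" "w \<in> Linf ss"
  shows "(\<lambda>s. v s + w s) \<in> Linf ss"
proof -
  obtain C D where CD: "AE s in sign_measure lborel ss. cmod (v s) \<le> C"
      "AE s in sign_measure lborel ss. cmod (w s) \<le> D"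
    using assms by (auto simp: Linf_def)
  have "AE s in sign_measure lborel ss. cmod (v s + w s) \<le> C + D"
    using CD by eventually_elim (rule norm_triangle_mono)
  then show ?thesis
    using assms by (auto simp: Linf_def)
qed

context operator_integrals
begin

lemma integral_scale:
  assumes "ss \<noteq> []" "admissible ss hs v" "f \<in> \<Theta>"
  shows "I ss hs (\<lambda>s. c * v s) f = c *\<^sub>C I ss hs v f"
  using linear_v[OF assms(1,2,2,3), of c 0] by simp

text \<open>Membership in \<open>Linf\<close> is part of the induction because
  \<open>linear_v\<close> needs the partial sum to be admissible.\<close>

lemma integral_sum:
  assumes "ss \<noteq> []" "length hs = length ss" "set hs \<subseteq> L2" "f \<in> \<Theta>"
    and "finite J" "\<And>j. j \<in> J \<Longrightarrow> v j \<in> Linf ss"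
  shows "(\<lambda>s. \<Sum>j\<in>J. v j s) \<in> Linf ss \<and>
    I ss hs (\<lambda>s. \<Sum>j\<in>J. v j s) f = (\<Sum>j\<in>J. I ss hs (v j) f)"
  using assms(5,6)
proof (induction J rule: finite_induct)
  case empty
  then show ?case
    \<comment> \<open>The integral of the zero function vanishes: it is 0 times itself.\<close>
    using integral_scale[OF assms(1) _ assms(4), of hs "\<lambda>_. 0" 0] assms(2,3)
    by (simp add: admissible_def const_in_Linf)
next
  case (insert j J)
  then have "I ss hs (\<lambda>s. 1 * v j s + 1 * (\<Sum>j\<in>J. v j s)) f
      = 1 *\<^sub>C I ss hs (v j) f + 1 *\<^sub>C I ss hs (\<lambda>s. \<Sum>j\<in>J. v j s) f"
    using assms(1-4) by (intro linear_v) (auto simp: admissible_def)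
  with insert show ?case
    by (simp add: add_in_Linf)
qed

text \<open>Each use of \<open>product\<close> prepends one factor, and the tensor of constants 1 is
  again 1. Exponents start at 1 since \<open>product\<close> requires nonempty sign lists.\<close>

lemma integral_power:
  assumes "h \<in> L2" "f \<in> \<Theta>"
  shows "(I [\<sigma>] [h] (\<lambda>_. 1) ^^ Suc n) f
    = I (replicate (Suc n) \<sigma>) (replicate (Suc n) h) (\<lambda>_. 1) f"
proof (induction n)
  case 0
  then show ?case by simp
next
  case (Suc n)
  let ?m = "Suc n"
  have "(I [\<sigma>] [h] (\<lambda>_. 1) ^^ Suc ?m) f
      = I [\<sigma>] [h] (\<lambda>_. 1) (I (replicate ?m \<sigma>) (replicate ?m h) (\<lambda>_. 1) f)"
    using Suc by simp
  also have "\<dots> = I ([\<sigma>] @ replicate ?m \<sigma>) ([h] @ replicate ?m h)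
      (tensor (length [\<sigma>]) (length (replicate ?m \<sigma>)) (\<lambda>_. 1) (\<lambda>_. 1)) f"
    by (rule product) (use assms in \<open>auto simp: admissible_def const_in_Linf\<close>)
  finally show ?case
    by (simp add: tensor_def)
qed

lemma integral_one_eq_sum_max_at:
  assumes "h \<in> L2" "f \<in> \<Theta>" "k > 0"
  shows "I (replicate k \<sigma>) (replicate k h) (\<lambda>_. 1) f
    = (\<Sum>j<k. I (replicate k \<sigma>) (replicate k h) (max_at k j) f)"
proof -
  let ?ss = "replicate k \<sigma>" and ?hs = "replicate k h"
  have Linf: "max_at k j \<in> Linf ?ss" if "j < k" for j
    using max_at_in_Linf[of j ?ss] that by simp
  have sum: "(\<lambda>s. \<Sum>j<k. max_at k j s) \<in> Linf ?ss \<and>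
      I ?ss ?hs (\<lambda>s. \<Sum>j<k. max_at k j s) f = (\<Sum>j<k. I ?ss ?hs (max_at k j) f)"
    by (rule integral_sum) (use assms Linf in auto)
  \<comment> \<open>Finitely many pairs, so almost everywhere all distinguished coordinates differ
    at once; this is the injectivity required by \<open>sum_max_at\<close>.\<close>
  have "AE x in sign_measure (lborel :: (real^'d) measure) ?ss.
      \<forall>(i, j) \<in> {(i, j). i < k \<and> j < k \<and> i \<noteq> j}. x i $ e \<noteq> x j $ e"
  proof (rule AE_finite_allI)
    show "finite {(i, j). i < k \<and> j < k \<and> i \<noteq> j}"
      by (rule finite_subset[of _ "{..<k} \<times> {..<k}"]) auto
  qed (auto intro!: AE_sign_measure_neq_component)
  then have "AE x in sign_measure lborel ?ss.
      integrand e ?hs (\<lambda>_. 1) x = integrand e ?hs (\<lambda>s. \<Sum>j<k. max_at k j s) x"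
  proof eventually_elim
    case (elim x)
    then have "inj_on (\<lambda>i\<in>{..<k}. x i $ e) {..<k}"
      by (auto simp: inj_on_def)
    from sum_max_at[OF assms(3) this] show ?case
      by (simp add: integrand_def)
  qed
  then have "I ?ss ?hs (\<lambda>_. 1) f = I ?ss ?hs (\<lambda>s. \<Sum>j<k. max_at k j s) f"
    by (intro AE_cong) (use assms sum const_in_Linf in \<open>auto simp: admissible_def\<close>)
  with sum show ?thesis
    by simp
qed

end

theorem theorem6:
  fixes k :: nat and q :: complex and \<eta> :: real
    and e :: "'d::finite"
    and \<Theta> :: "'g::complex_hilbert_space set"
    and I :: "sign list \<Rightarrow> (real^'d \<Rightarrow> complex) list \<Rightarrow> ((nat \<Rightarrow> real) \<Rightarrow> complex) \<Rightarrow> 'g \<Rightarrow> 'g"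
    and h :: "real^'d \<Rightarrow> complex"
  assumes "k \<ge> 2"
    and "q \<noteq> 1"
    and "q ^ k = 1"
    and "CARD('d) \<ge> 2"
    and "operator_integrals e (anyon_Q q \<eta>) \<Theta> I"
    and "h \<in> L2"
  shows "\<forall>f\<in>\<Theta>. (I [Pos] [h] (\<lambda>_. 1) ^^ k) f = 0"
proof
  fix f assume f: "f \<in> \<Theta>"
  interpret operator_integrals e "anyon_Q q \<eta>" \<Theta> I
    by fact
  let ?J = "\<lambda>v. I (replicate k Pos) (replicate k h) v f"
  have adm: "admissible (replicate k Pos) (replicate k h) (max_at k j)" if "j < k" for j
    using max_at_in_Linf[of j "replicate k Pos"] that assms(6) by (simp add: admissible_def)
  \<comment> \<open>All signs and all functions agree, so the swap changes neither list and only
    \<open>max_at k j\<close> is transformed.\<close>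
  have step: "?J (max_at k j) = q *\<^sub>C ?J (max_at k (Suc j))" if "Suc j < k" for j
    using commutation_same[OF adm, of j j f] integral_scale[OF _ adm f, of "Suc j" q] that f
    by (simp add: swap_at_replicate Psi_max_at)
  \<comment> \<open>Counting down from \<open>k - 1\<close> makes the exponent of \<open>q\<close>
    the number of commutations still needed to reach the last index.\<close>
  have top: "?J (max_at k (k - Suc j)) = q ^ j *\<^sub>C ?J (max_at k (k - 1))" if "j < k" for j
    using that
  proof (induction j)
    case (Suc j)
    then have "?J (max_at k (k - Suc (Suc j))) = q *\<^sub>C ?J (max_at k (k - Suc j))"
      using step[of "k - Suc (Suc j)"] by (simp add: Suc_diff_Suc)
    with Suc show ?case
      by simp
  qed simp
  have "(I [Pos] [h] (\<lambda>_. 1) ^^ k) f = ?J (\<lambda>_. 1)"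
    using integral_power[OF assms(6) f, where \<sigma> = Pos and n = "k - 1"] assms(1) by simp
  also have "\<dots> = (\<Sum>j<k. ?J (max_at k j))"
    using integral_one_eq_sum_max_at[OF assms(6) f, where \<sigma> = Pos and k = k] assms(1) by simp
  also have "\<dots> = (\<Sum>j<k. ?J (max_at k (k - Suc j)))"
    by (rule sum.nat_diff_reindex[symmetric])
  also have "\<dots> = (\<Sum>j<k. q ^ j *\<^sub>C ?J (max_at k (k - 1)))"
    by (intro sum.cong refl top) simp
  also have "\<dots> = (\<Sum>j<k. q ^ j) *\<^sub>C ?J (max_at k (k - 1))"
    by (simp add: complex_vector.scale_sum_left)
  \<comment> \<open>The geometric sum is \<open>(q ^ k - 1) / (q - 1)\<close>, with zero numerator
    and nonzero denominator.\<close>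
  also have "(\<Sum>j<k. q ^ j) = 0"
    using geometric_sum[OF assms(2), of k] assms(3) by simp
  finally show "(I [Pos] [h] (\<lambda>_. 1) ^^ k) f = 0"
    by simp
qed

end
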